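(* Let $p_1,p_2,\ldots$ be independent random variables, each uniformly distributed on $[0,1]$. For each $i\ge 1$ let $f_i:[0,1]\to\mathbb{R}$ be an integrable function with $\int_0^1 f_i(p)\,dp=0$, and define $S_n=\sum_{i=1}^n f_i(p_i)$ for $n=1,2,\ldots$. Then $\{S_n\}_{n=1}^\infty$ is a martingale, i.e. for every $n\ge 1$, $$E(S_{n+1}\mid S_n,S_{n-1},\ldots,S_1)=S_n.$$
   Context: A sequence of random variables $\{S_n\}_{n=1}^\infty$ is called a martingale if $E(S_{n+1}\mid S_n,\ldots,S_1)=S_n$ (almost surely) for every $n\ge1$. The functions $f_i$ are called betting functions, and $\{S_n\}$ is called the additive martingale. *)

theory Defs
  imports "HOL-Probability.Probability"
begin

definition past_algebra :: "'a measure \<Rightarrow> (nat \<Rightarrow> 'a \<Rightarrow> real) \<Rightarrow> nat \<Rightarrow> 'a measure" where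
  "past_algebra M S n =
     vimage_algebra (space M) (\<lambda>\<omega>. \<lambda>k\<in>{1..n}. S k \<omega>) (\<Pi>\<^sub>M k\<in>{1..n}. borel)"

text \<open>Sequences are indexed from 1; the value of \<open>S\<close> at 0 plays no role.
  Integrability is required explicitly because \<^const>\<open>real_cond_exp\<close> is total and
  returns a meaningless value on non-integrable functions.\<close>

definition martingale :: "'a measure \<Rightarrow> (nat \<Rightarrow> 'a \<Rightarrow> real) \<Rightarrow> bool" where
  "martingale M S \<longleftrightarrow>
     (\<forall>n\<ge>1. integrable M (S n)) \<and>
     (\<forall>n\<ge>1. AE \<omega> in M. real_cond_exp M (past_algebra M S n) (S (Suc n)) \<omega> = S n \<omega>)"

end

theory Submission
  imports Defs
begin

text \<open>The increment S_{n+1} - S_n = f_{n+1}(p_{n+1}) has mean zero and is independent of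
  (p_1,...,p_n), hence of (S_1,...,S_n), which is a Borel function of f_1(p_1),...,f_n(p_n). So for
  every event A determined by S_1,...,S_n, the integral of the increment over A factors as P(A) * 0
  = 0. Thus S_{n+1} and S_n have the same integral over every such A, and since S_n is itself
  determined by the past, it is the conditional expectation.
  \<open>martingale_sum_indep_centered\<close> carries out this argument for arbitrary independent,
  integrable, centered summands. \<open>uniform_unit_interval_transfer\<close> turns the hypotheses
  on integrals of f_i over [0,1] into integrability and mean zero of f_i(p_i).\<close>

lemma (in prob_space) martingale_sum_indep_centered:
  fixes X :: "nat \<Rightarrow> 'a \<Rightarrow> real"
  assumes indep: "indep_vars (\<lambda>_. borel) X {1..}"
    and integrable: "\<And>i. i \<ge> 1 \<Longrightarrow> integrable M (X i)"
    and centered: "\<And>i. i \<ge> 1 \<Longrightarrow> expectation (X i) = 0"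
  shows "martingale M (\<lambda>n \<omega>. \<Sum>i=1..n. X i \<omega>)"
  unfolding martingale_def
proof (intro conjI allI impI)
  define S where "S n \<omega> = (\<Sum>i=1..n. X i \<omega>)" for n \<omega>
  have S_integrable: "integrable M (S n)" for n
    unfolding S_def by (intro Bochner_Integration.integrable_sum integrable) auto
  then show "integrable M (\<lambda>\<omega>. \<Sum>i=1..n. X i \<omega>)" for n
    unfolding S_def .
  fix n :: nat
  assume "n \<ge> 1"
  define past where "past \<omega> = (\<lambda>k\<in>{1..n}. S k \<omega>)" for \<omega>
  let ?P = "\<Pi>\<^sub>M k\<in>{1..n}. (borel :: real measure)"
  let ?F = "past_algebra M S n"
  have F_eq: "?F = vimage_algebra (space M) past ?P"
    unfolding past_algebra_def past_def ..
  have past_space: "past \<in> space M \<rightarrow> space ?P"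
    by (auto simp: past_def space_PiM)
  have past_F: "past \<in> measurable ?F ?P"
    unfolding F_eq by (rule measurable_vimage_algebra1[OF past_space])
  have past_M: "past \<in> measurable M ?P"
    unfolding past_def using S_integrable by (intro measurable_restrict) auto
  \<comment> \<open>Every event of the past is the preimage of a single product-measurable set B
    under the vector \<open>past\<close>, so no generator argument is needed later.\<close>
  have sets_F: "sets ?F = {past -` B \<inter> space M | B. B \<in> sets ?P}"
    unfolding F_eq by (rule sets_vimage_algebra2[OF past_space])
  have "subalgebra M ?F"
    unfolding subalgebra_def sets_F using past_M
    by (auto simp: past_algebra_def)
  then interpret finite_measure_subalgebra M ?F
    by unfold_locales

  have S_F: "S n \<in> borel_measurable ?F"
  proof -
    \<comment> \<open>S_n is the last coordinate of \<open>past\<close>; n \<ge> 1 ensures that n is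
      in the index set.\<close>
    have "(\<lambda>\<omega>. past \<omega> n) \<in> borel_measurable ?F"
      using measurable_compose[OF past_F measurable_component_singleton, of n] \<open>n \<ge> 1\<close> by simp
    then show ?thesis
      using \<open>n \<ge> 1\<close> by (simp add: past_def)
  qed

  \<comment> \<open>Independence is given for the summands, while the past is generated by their
    partial sums. \<open>psum\<close> is the deterministic map from the former to the
    latter.\<close>
  define psum :: "(nat \<Rightarrow> real) \<Rightarrow> nat \<Rightarrow> real"
    where "psum x = (\<lambda>k\<in>{1..n}. \<Sum>i=1..k. x i)" for x
  have psum_measurable: "psum \<in> measurable ?P ?P"
    unfolding psum_def[abs_def]
    by (intro measurable_restrict borel_measurable_sum measurable_component_singleton) auto
  have past_eq: "past \<omega> = psum (\<lambda>i\<in>{1..n}. X i \<omega>)" for \<omega>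
    unfolding past_def psum_def S_def by (intro restrict_ext sum.cong) auto

  have increment: "(\<integral>\<omega>. indicator A \<omega> * X (Suc n) \<omega> \<partial>M) = 0" if A: "A \<in> sets ?F" for A
  proof -
    obtain B where B: "B \<in> sets ?P" "A = past -` B \<inter> space M"
      using A unfolding sets_F by auto
    have ind_B: "indicator B \<circ> psum \<in> borel_measurable ?P"
      using psum_measurable B(1) by (intro measurable_comp) auto
    \<comment> \<open>The index blocks {1..n} and {n+1} are disjoint. The new summand first appears
      as a one-coordinate vector and is then recovered by projection, while
      \<open>indicator B \<circ> psum\<close> turns the other block into the indicator of A.\<close>
    have "indep_var ?P (\<lambda>\<omega>. \<lambda>i\<in>{1..n}. X i \<omega>)
       (\<Pi>\<^sub>M i\<in>{Suc n}. borel) (\<lambda>\<omega>. \<lambda>i\<in>{Suc n}. X i \<omega>)"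
      by (rule indep_var_restrict[OF indep]) auto
    then have "indep_var borel ((indicator B \<circ> psum) \<circ> (\<lambda>\<omega>. \<lambda>i\<in>{1..n}. X i \<omega>))
        borel ((\<lambda>x. x (Suc n)) \<circ> (\<lambda>\<omega>. \<lambda>i\<in>{Suc n}. X i \<omega>))"
      by (rule indep_var_compose[OF _ ind_B measurable_component_singleton]) simp
    also have "(indicator B \<circ> psum) \<circ> (\<lambda>\<omega>. \<lambda>i\<in>{1..n}. X i \<omega>) = (\<lambda>\<omega>. indicator B (past \<omega>) :: real)"
      by (simp add: fun_eq_iff past_eq)
    also have "(\<lambda>x. x (Suc n)) \<circ> (\<lambda>\<omega>. \<lambda>i\<in>{Suc n}. X i \<omega>) = X (Suc n)"
      by (simp add: fun_eq_iff)
    finally have ind: "indep_var borel (\<lambda>\<omega>. indicator B (past \<omega>) :: real) borel (X (Suc n))" .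
    have "integrable M (\<lambda>\<omega>. indicator B (past \<omega>) :: real)"
      using measurable_compose[OF past_M borel_measurable_indicator[OF B(1)]]
      by (intro integrable_const_bound[where B = 1]) auto
    then have "(\<integral>\<omega>. indicator B (past \<omega>) * X (Suc n) \<omega> \<partial>M) =
        expectation (\<lambda>\<omega>. indicator B (past \<omega>)) * expectation (X (Suc n))"
      using indep_var_lebesgue_integral[OF ind] integrable by simp
    also have "\<dots> = 0"
      using centered by simp
    also have "(\<integral>\<omega>. indicator B (past \<omega>) * X (Suc n) \<omega> \<partial>M) =
        (\<integral>\<omega>. indicator A \<omega> * X (Suc n) \<omega> \<partial>M)"
      unfolding B(2) by (intro Bochner_Integration.integral_cong) (auto simp: indicator_def)
    finally show ?thesis .
  qed

  have "AE \<omega> in M. real_cond_exp M ?F (S (Suc n)) \<omega> = S n \<omega>"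
  \<comment> \<open>Conditional expectation is characterized by measurability with respect to the
    past (\<open>S_F\<close>) and equal integrals over all past events; the latter reduces to
    \<open>increment\<close>.\<close>
  proof (rule real_cond_exp_charact[OF _ S_integrable S_integrable S_F])
    fix A assume A: "A \<in> sets ?F"
    then have A_M: "A \<in> sets M"
      using subalg by (auto simp: subalgebra_def)
    have "(\<integral>\<omega>\<in>A. S (Suc n) \<omega> \<partial>M) =
        (\<integral>\<omega>. indicator A \<omega> * S n \<omega> + indicator A \<omega> * X (Suc n) \<omega> \<partial>M)"
      by (simp add: set_lebesgue_integral_def S_def algebra_simps)
    also have "\<dots> = (\<integral>\<omega>. indicator A \<omega> * S n \<omega> \<partial>M) + (\<integral>\<omega>. indicator A \<omega> * X (Suc n) \<omega> \<partial>M)"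
      using integrable_mult_indicator[OF A_M S_integrable]
        integrable_mult_indicator[OF A_M integrable]
      by (intro Bochner_Integration.integral_add) auto
    also have "\<dots> = (\<integral>\<omega>\<in>A. S n \<omega> \<partial>M)"
      using increment[OF A] by (simp add: set_lebesgue_integral_def)
    finally show "(\<integral>\<omega>\<in>A. S (Suc n) \<omega> \<partial>M) = (\<integral>\<omega>\<in>A. S n \<omega> \<partial>M)" .
  qed
  then show "AE \<omega> in M. real_cond_exp M (past_algebra M (\<lambda>n \<omega>. \<Sum>i=1..n. X i \<omega>) n)
      (\<lambda>\<omega>. \<Sum>i=1..Suc n. X i \<omega>) \<omega> = (\<Sum>i=1..n. X i \<omega>)"
    unfolding S_def .
qed

text \<open>This is change of variables: the law of p is Lebesgue measure cut down to [0,1]. Since h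
  is controlled only on [0,1], the proof replaces it by its extension by zero, which agrees with h
  at every value of p.\<close>

lemma uniform_unit_interval_transfer:
  fixes h :: "real \<Rightarrow> real"
  assumes p: "p \<in> measurable M (restrict_space borel {0..1})"
    and distr: "distr M lborel p = uniform_measure lborel {0..1}"
    and h: "set_integrable lborel {0..1} h"
  shows "integrable M (\<lambda>\<omega>. h (p \<omega>))"
    and "(\<integral>\<omega>. h (p \<omega>) \<partial>M) = (LBINT x:{0..1}. h x)"
proof -
  define g where "g x = indicator {0..1} x * h x" for x
  have g: "integrable lborel g"
    using h by (simp add: set_integrable_def g_def[abs_def])
  then have g_meas: "g \<in> borel_measurable lborel"
    by auto
  have p_meas: "p \<in> measurable M lborel" and p_range: "p \<in> space M \<rightarrow> {0..1}"
    using p by (auto simp: measurable_restrict_space2_iff)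
  have hg: "h (p \<omega>) = g (p \<omega>)" if "\<omega> \<in> space M" for \<omega>
    using funcset_mem[OF p_range that] by (simp add: g_def)
  \<comment> \<open>The normalizing factor disappears because [0,1] has length 1.\<close>
  have distr': "distr M lborel p = density lborel (\<lambda>x. ennreal (indicator {0..1} x))"
    unfolding distr uniform_measure_def by (simp add: divide_ennreal_def ennreal_indicator)
  have ind_g: "(\<lambda>x. indicator {0..1} x *\<^sub>R g x) = g"
    by (auto simp: g_def indicator_def fun_eq_iff)
  have "integrable (distr M lborel p) g"
    unfolding distr' by (subst integrable_density) (use g g_meas ind_g in auto)
  then have "integrable M (\<lambda>\<omega>. g (p \<omega>))"
    using integrable_distr[OF p_meas] by blast
  then show "integrable M (\<lambda>\<omega>. h (p \<omega>))"
    by (simp cong: Bochner_Integration.integrable_cong add: hg)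
  have "(\<integral>\<omega>. h (p \<omega>) \<partial>M) = (\<integral>\<omega>. g (p \<omega>) \<partial>M)"
    by (rule Bochner_Integration.integral_cong[OF refl hg])
  also have "\<dots> = (\<integral>x. g x \<partial>distr M lborel p)"
    by (rule integral_distr[OF p_meas g_meas, symmetric])
  also have "\<dots> = (\<integral>x. g x \<partial>lborel)"
    unfolding distr' by (subst integral_density) (use g_meas ind_g in auto)
  finally show "(\<integral>\<omega>. h (p \<omega>) \<partial>M) = (LBINT x:{0..1}. h x)"
    by (simp add: set_lebesgue_integral_def g_def)
qed

theorem mainTheorem2:
  fixes M :: "'a measure"
    and p :: "nat \<Rightarrow> 'a \<Rightarrow> real"
    and f :: "nat \<Rightarrow> real \<Rightarrow> real"
  assumes "prob_space M"
    and "prob_space.indep_vars M (\<lambda>_. restrict_space borel {0..1}) p {1..}"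
    and "\<And>i. i \<ge> 1 \<Longrightarrow> distr M lborel (p i) = uniform_measure lborel {0..1}"
    and "\<And>i. i \<ge> 1 \<Longrightarrow> set_integrable lborel {0..1} (f i)"
    and "\<And>i. i \<ge> 1 \<Longrightarrow> (LBINT x:{0..1}. f i x) = 0"
  shows "martingale M (\<lambda>n \<omega>. \<Sum>i=1..n. f i (p i \<omega>))"
proof -
  interpret prob_space M by fact
  have p: "p i \<in> measurable M (restrict_space borel {0..1})" if "i \<ge> 1" for i
    using assms(2) that by (auto simp: indep_vars_def)
  \<comment> \<open>Set integrability gives measurability of f_i on [0,1] only, which suffices for
    composition because p_i takes its values in the restricted space.\<close>
  have f: "f i \<in> borel_measurable (restrict_space borel {0..1})" if "i \<ge> 1" for i
    using borel_measurable_integrable[OF assms(4)[OF that, unfolded set_integrable_def]]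
    by (simp add: borel_measurable_restrict_space_iff)
  show ?thesis
  proof (rule martingale_sum_indep_centered)
    show "indep_vars (\<lambda>_. borel) (\<lambda>i \<omega>. f i (p i \<omega>)) {1..}"
      by (rule indep_vars_compose2[OF assms(2)]) (use f in auto)
    fix i :: nat assume i: "i \<ge> 1"
    note transfer = uniform_unit_interval_transfer[OF p[OF i] assms(3)[OF i] assms(4)[OF i]]
    show "integrable M (\<lambda>\<omega>. f i (p i \<omega>))"
      by (rule transfer(1))
    show "expectation (\<lambda>\<omega>. f i (p i \<omega>)) = 0"
      using transfer(2) assms(5)[OF i] by simp
  qed
qed

end
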